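(* Assume the following statement $(\ast)$ holds: for every odd, square-free positive integer $n$ divisible by $3$ such that there exists $p\in\{5,7,13\}$ with $p\mid n$ and $r\nmid n$ for every $r\in\{5,7,13\}\setminus\{p\}$, and such that there exists $q\in T(3p)\setminus\{5,7,13\}$ with $q\nmid n$, one has $t(n)\geq 4$. Then for every positive integer $n$: $t(n)\geq 1$; if $5\nmid n$, then $t(n)\geq 2$; and if $3\mid n$, then $t(n)\geq 3$.
   Context: For an integer $n$, a Toda prime of $n$ is an odd prime $p$ such that $p-1\mid 4n$ and $\gcd\!\left(p,\frac{4n}{p-1}\right)=1$. $T(n)$ denotes the set of Toda primes of $n$, and $t(n):=|T(n)|$. *)

theory Defs
  imports "HOL-Computational_Algebra.Squarefree" "HOL-Computational_Algebra.Primes"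
begin

definition toda_prime :: "int \<Rightarrow> int \<Rightarrow> bool" where
  "toda_prime n p \<longleftrightarrow>
     prime p \<and> odd p \<and> (p - 1) dvd 4 * n \<and> gcd p (4 * n div (p - 1)) = 1"

definition toda_primes :: "int \<Rightarrow> int set" where
  "toda_primes n = {p. toda_prime n p}"

definition toda_count :: "int \<Rightarrow> nat" where
  "toda_count n = card (toda_primes n)"

text \<open>All the sets \<open>toda_primes n\<close> are finite (\<open>toda_primes 0\<close> is empty, as \<open>gcd p 0 = p\<close>), so the
  cardinality above is never the default value for infinite sets.\<close>

lemma finite_toda_primes: "finite (toda_primes n)"
proof (cases "n = 0")
  case True
  have "toda_primes n = {}"
  proof -
    have False if "toda_prime 0 p" for p
    proof -
      have "prime p" "gcd p 0 = 1"
        using that by (simp_all add: toda_prime_def)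
      moreover have "p > 1"
        using \<open>prime p\<close> by (rule prime_gt_1_int)
      ultimately show False
        by simp
    qed
    then show ?thesis
      unfolding toda_primes_def True by blast
  qed
  then show ?thesis by simp
next
  case False
  have "toda_primes n \<subseteq> (\<lambda>d. d + 1) ` {d. d dvd 4 * n}"
  proof
    fix p assume "p \<in> toda_primes n"
    then have "p - 1 \<in> {d. d dvd 4 * n}"
      by (simp add: toda_primes_def toda_prime_def)
    then show "p \<in> (\<lambda>d. d + 1) ` {d. d dvd 4 * n}"
      by (rule rev_image_eqI) simp
  qed
  moreover have "finite {d. d dvd 4 * n}"
    by (rule finite_divisors_int) (use False in simp)
  ultimately show ?thesis
    by (rule finite_subset[OF _ finite_imageI])
qed

end

theory Submission
  imports Defs
begin

text \<open>Since \<open>T(n)\<close> consists of the odd primes \<open>p\<close> with \<open>p - 1 dvd 4n\<close> not dividing \<open>n\<close>, an upper bound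
  \<open>T(n) \<subseteq> F\<close> says that the primes of \<open>n\<close> are closed under adjoining an odd prime outside \<open>F\<close>
  that is one more than a divisor of \<open>4m\<close>, for \<open>m\<close> squarefree with all its primes already present.
  For each of the three pairs \<open>(p, q) = (5, 11), (7, 29), (13, 53)\<close> the hypothesis shows that the
  least set closed in this sense, with \<open>F\<close> consisting of \<open>q\<close> and the two elements of
  \<open>{5, 7, 13} - {p}\<close>, is infinite, and hence contains an element of \<open>T(n)\<close> for every nonzero \<open>n\<close>.
  Any two of the three sets meet only in \<open>3\<close>: another common prime \<open>s\<close>, taken least, would have
  \<open>s - 1 dvd 12\<close>, so \<open>s \<in> {5, 7, 13}\<close>. Thus \<open>3 dvd n\<close> yields three distinct Toda primes.\<close>

text \<open>An odd prime \<open>p\<close> is coprime to both \<open>p - 1\<close> and 4, so it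
  divides the quotient of \<open>4 * n\<close> by \<open>p - 1\<close> exactly when it divides
  \<open>n\<close>.\<close>

lemma toda_prime_iff:
  "toda_prime n p \<longleftrightarrow> prime p \<and> odd p \<and> (p - 1) dvd 4 * n \<and> \<not> p dvd n"
proof -
  have "gcd p (4 * n div (p - 1)) = 1 \<longleftrightarrow> \<not> p dvd n"
    if p: "prime p" "odd p" and d: "(p - 1) dvd 4 * n"
  proof -
    from d obtain k where k: "4 * n = (p - 1) * k" by blast
    have "p > 1" using p(1) by (rule prime_gt_1_int)
    then have "p dvd k \<longleftrightarrow> p dvd (p - 1) * k"
      using p(1) by (auto simp: prime_dvd_mult_iff dest: zdvd_imp_le)
    also have "\<dots> \<longleftrightarrow> p dvd 2 * (2 * n)" using k by simp
    also have "\<dots> \<longleftrightarrow> p dvd n"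
    proof -
      have "\<not> p dvd 2"
        using p \<open>p > 1\<close> primes_dvd_imp_eq[of p 2] by auto
      then show ?thesis
        using p(1) by (simp only: prime_dvd_mult_iff) simp
    qed
    finally have "p dvd k \<longleftrightarrow> p dvd n" .
    moreover have "4 * n div (p - 1) = k" using k \<open>p > 1\<close> by simp
    moreover have "gcd p k = 1 \<longleftrightarrow> \<not> p dvd k"
      using p(1) \<open>p > 1\<close> by (metis coprime_iff_gcd_eq_1 prime_imp_coprime not_coprimeI dvd_refl not_prime_unit)
    ultimately show ?thesis by simp
  qed
  then show ?thesis unfolding toda_prime_def by metis
qed

lemma squarefree_dvdI:
  fixes m n :: "'a :: factorial_semiring"
  assumes "squarefree m" and "\<And>r. prime r \<Longrightarrow> r dvd m \<Longrightarrow> r dvd n"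
  shows "m dvd n"
proof (cases "n = 0")
  case False
  have "m \<noteq> 0" using assms(1) by auto
  show ?thesis
  proof (rule multiplicity_le_imp_dvd)
    fix r :: 'a assume r: "prime r"
    have "multiplicity r m \<le> 1"
      using assms(1) r \<open>m \<noteq> 0\<close> by (simp add: squarefree_factorial_semiring'')
    moreover have "multiplicity r n \<ge> 1" if "r dvd m"
      using assms(2)[OF r that] r False by (simp add: multiplicity_geI)
    moreover have "multiplicity r m = 0" if "\<not> r dvd m"
      using that by (rule not_dvd_imp_multiplicity_0)
    ultimately show "multiplicity r m \<le> multiplicity r n"
      by (cases "r dvd m") auto
  qed (fact \<open>m \<noteq> 0\<close>)
qed simp

lemma squarefree_prod_primes:
  fixes A :: "int set"
  assumes "finite A" and "\<And>r. r \<in> A \<Longrightarrow> prime r"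
  shows "squarefree (\<Prod>A)"
proof (rule squarefree_prod_coprime)
  show "coprime a b" if "a \<in> A" "b \<in> A" "a \<noteq> b" for a b
    using that assms(2) primes_coprime by blast
qed (use assms(2) in \<open>auto intro: squarefree_prime\<close>)

text \<open>Taking \<open>m = 1\<close> seeds the set with those of 3 and 5 that lie outside
  \<open>F\<close>. Squarefreeness of \<open>m\<close> makes it divide every number divisible by all
  its primes.\<close>

inductive_set toda_closure :: "int set \<Rightarrow> int set" for F :: "int set" where
  adjoin: "prime s \<Longrightarrow> odd s \<Longrightarrow> s \<notin> F \<Longrightarrow> squarefree m \<Longrightarrow>
    (\<And>r. prime r \<Longrightarrow> r dvd m \<Longrightarrow> r \<in> toda_closure F) \<Longrightarrow> s - 1 dvd 4 * m \<Longrightarrow> s \<in> toda_closure F"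

lemma toda_closureD:
  assumes "s \<in> toda_closure F"
  shows "prime s" "odd s" "s \<notin> F"
  using assms by (auto elim: toda_closure.cases)

lemma base_in_toda_closure:
  assumes "s \<in> {3, 5}" "s \<notin> F"
  shows "s \<in> toda_closure F"
  by (rule toda_closure.adjoin[where m = 1]) (use assms in auto)

lemma base_in_toda_closure':
  assumes "s \<in> {5, 7, 13}" "s \<notin> F" "3 \<notin> F"
  shows "s \<in> toda_closure F"
proof (rule toda_closure.adjoin[where m = 3])
  show "r \<in> toda_closure F" if "prime r" "r dvd 3" for r
    using that primes_dvd_imp_eq[of r 3] base_in_toda_closure[of 3 F] assms by simp
qed (use assms in \<open>auto intro: squarefree_prime\<close>)

text \<open>By induction the primes of \<open>m\<close> divide \<open>n\<close>, so
  \<open>s - 1\<close> divides \<open>4 * n\<close>; if \<open>s\<close> did not divide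
  \<open>n\<close>, it would be a Toda prime of \<open>n\<close>.\<close>

lemma toda_closure_dvd:
  assumes "s \<in> toda_closure F" and "toda_closure F \<inter> toda_primes n = {}"
  shows "s dvd n"
  using assms(1)
proof induction
  case (adjoin s m)
  have "m dvd n"
    using adjoin.hyps(4) adjoin.IH by (rule squarefree_dvdI)
  then have "s - 1 dvd 4 * n"
    using adjoin.hyps(6) by (meson dvd_trans mult_dvd_mono dvd_refl)
  moreover have "s \<in> toda_closure F"
    using adjoin.hyps by (rule toda_closure.adjoin)
  then have "s \<notin> toda_primes n" using assms(2) by blast
  ultimately show ?case
    using adjoin.hyps(1,2) by (simp add: toda_primes_def toda_prime_iff)
qed

text \<open>A Toda prime outside \<open>F\<close> could be adjoined with the product itself as
  \<open>m\<close>, and would then divide that product.\<close>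

lemma toda_primes_prod_closure:
  assumes "finite (toda_closure F)"
  shows "toda_primes (\<Prod>(toda_closure F)) \<subseteq> F"
proof
  let ?m = "\<Prod>(toda_closure F)"
  fix s assume "s \<in> toda_primes ?m"
  then have s: "prime s" "odd s" "s - 1 dvd 4 * ?m" "\<not> s dvd ?m"
    by (auto simp: toda_primes_def toda_prime_iff)
  show "s \<in> F"
  proof (rule ccontr)
    assume "s \<notin> F"
    have closed: "r \<in> toda_closure F" if "prime r" "r dvd ?m" for r
      using that assms by (metis prime_dvd_prod_iff primes_dvd_imp_eq toda_closureD(1))
    have "squarefree ?m"
      using assms toda_closureD(1) by (rule squarefree_prod_primes)
    with s(1,2) \<open>s \<notin> F\<close> have "s \<in> toda_closure F"
      using closed s(3)
      by (rule toda_closure.adjoin)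
    then show False
      using s(4) dvd_prodI[OF assms, of s "\<lambda>x. x"] by simp
  qed
qed

lemma toda_closure_Int:
  assumes "s \<in> toda_closure F" "s \<in> toda_closure G" "{5, 7, 13} \<subseteq> F \<union> G"
  shows "s = 3"
  using assms(1,2)
proof (induction "nat s" arbitrary: s rule: less_induct)
  case less
  note s = toda_closureD[OF less.prems(1)] toda_closureD(3)[OF less.prems(2)]
  have "s > 1" using s(1) by (rule prime_gt_1_int)
  obtain m where m: "squarefree m" "s - 1 dvd 4 * m"
      "\<And>r. prime r \<Longrightarrow> r dvd m \<Longrightarrow> r \<in> toda_closure F"
    using less.prems(1) by (auto elim: toda_closure.cases)
  obtain m' where m': "s - 1 dvd 4 * m'"
      "\<And>r. prime r \<Longrightarrow> r dvd m' \<Longrightarrow> r \<in> toda_closure G"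
    using less.prems(2) by (auto elim: toda_closure.cases)
  \<comment> \<open>The primes of \<open>k\<close> are smaller than \<open>s\<close> and turn out to
    lie in both closures, so by induction only 3 can occur.\<close>
  define k where "k = gcd (s - 1) m"
  have "k dvd 3"
  proof (rule squarefree_dvdI)
    show "squarefree k"
      unfolding k_def by (rule squarefree_mono[OF _ m(1)]) simp
    fix r assume r: "prime r" "r dvd k"
    then have rs: "r dvd s - 1" and "r \<in> toda_closure F"
      using m(3) by (auto simp: k_def)
    \<comment> \<open>Being odd, \<open>r\<close> passes from \<open>4 * m'\<close> to
      \<open>m'\<close>, which places it in the second closure as well.\<close>
    have "\<not> r dvd 2"
      using r(1) toda_closureD(2)[OF \<open>r \<in> toda_closure F\<close>] primes_dvd_imp_eq[of r 2] by auto
    moreover have "r dvd 2 * (2 * m')"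
      using dvd_trans[OF rs m'(1)] by simp
    ultimately have "r dvd m'"
      using r(1) by (simp only: prime_dvd_mult_iff) simp
    then have "r \<in> toda_closure G" using r(1) m'(2) by blast
    moreover have "nat r < nat s"
      using zdvd_imp_le[OF rs] \<open>s > 1\<close> by simp
    ultimately show "r dvd 3"
      using less.hyps[of r] \<open>r \<in> toda_closure F\<close> by simp
  qed
  have "s - 1 dvd gcd (4 * (s - 1)) (4 * m)" using m(2) dvd_triv_right by (rule gcd_greatest[rotated])
  also have "\<dots> = 4 * k" using gcd_mult_distrib_int[of 4 "s - 1" m] by (simp only: k_def)
  also have "\<dots> dvd 4 * 3" using \<open>k dvd 3\<close> by (rule mult_dvd_mono[OF dvd_refl])
  finally have d: "s - 1 dvd 12" by simp
  then have "s - 1 \<le> 12" by (rule zdvd_imp_le) simp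
  then have "s \<in> {2..13}" using \<open>s > 1\<close> by simp
  moreover have "{2..13} = {2, 3, 4, 5, 6, 7, 8, 9, 10, 11, 12, 13 :: int}" by auto presburger
  \<comment> \<open>The odd primes with \<open>s - 1\<close> dividing 12 are 3, 5, 7 and 13, and the
    last three lie in \<open>F\<close> or in \<open>G\<close>.\<close>
  ultimately show ?case
    using s d assms(3) by auto
qed

text \<open>Otherwise the closure consists of divisors of \<open>n\<close> and is finite. Its
  product then satisfies the premises of \<open>star\<close>, yet all its Toda primes lie in the set
  \<open>F\<close> of at most three elements.\<close>

lemma toda_closure_meets_toda_primes:
  fixes n p q :: int
  defines "F \<equiv> insert q ({5, 7, 13} - {p})"
  assumes star: "\<forall>n::int. n > 0 \<and> odd n \<and> squarefree n \<and> 3 dvd n \<and>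
      (\<exists>p\<in>{5, 7, 13}. p dvd n \<and> (\<forall>r\<in>{5, 7, 13} - {p}. \<not> r dvd n) \<and>
         (\<exists>q\<in>toda_primes (3 * p) - {5, 7, 13}. \<not> q dvd n))
      \<longrightarrow> toda_count n \<ge> 4"
    and "n \<noteq> 0" and p: "p \<in> {5, 7, 13}" and q: "q \<in> toda_primes (3 * p) - {5, 7, 13}"
  shows "toda_closure F \<inter> toda_primes n \<noteq> {}"
proof
  assume "toda_closure F \<inter> toda_primes n = {}"
  then have "toda_closure F \<subseteq> {d. d dvd n}"
    using toda_closure_dvd by blast
  then have fin: "finite (toda_closure F)"
    using finite_divisors_int[OF \<open>n \<noteq> 0\<close>] by (rule finite_subset)
  define m where "m = \<Prod>(toda_closure F)"
  have dvd_m: "r dvd m \<longleftrightarrow> r \<in> toda_closure F" if "prime r" for r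
    using that fin unfolding m_def
    by (metis prime_dvd_prod_iff primes_dvd_imp_eq toda_closureD(1) dvd_refl)
  have pF: "p \<notin> F" and F3: "3 \<notin> F" and pq: "prime q" "odd q" "q \<in> F"
    using p q by (auto simp: F_def toda_primes_def toda_prime_iff)
  have "m > 0"
    unfolding m_def by (rule prod_pos) (use toda_closureD(1) prime_gt_0_int in blast)
  moreover have "odd m"
    using dvd_m[of 2] toda_closureD(2)[of 2 F] by auto
  moreover have "squarefree m"
    unfolding m_def using fin toda_closureD(1) by (rule squarefree_prod_primes)
  moreover have "3 dvd m"
    using dvd_m[of 3] base_in_toda_closure[of 3 F] F3 by simp
  moreover have "p dvd m"
    using dvd_m[of p] base_in_toda_closure'[OF p pF F3] p by auto
  moreover have "\<not> r dvd m" if "r \<in> {5, 7, 13} - {p}" for r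
    using that dvd_m[of r] toda_closureD(3)[of r F] by (auto simp: F_def)
  moreover have "\<not> q dvd m"
    using pq dvd_m toda_closureD(3) by blast
  ultimately have "toda_count m \<ge> 4"
    using star p q by blast
  moreover have "toda_count m \<le> card F"
    unfolding toda_count_def m_def
    by (rule card_mono[OF _ toda_primes_prod_closure[OF fin]]) (simp add: F_def)
  moreover have "card F \<le> Suc (card ({5, 7, 13} - {p}))"
    unfolding F_def by (simp add: card_insert_le_m1)
  moreover have "card ({5, 7, 13} - {p}) = 2"
    using p by (simp add: card_Diff_singleton)
  ultimately show False by simp
qed

theorem theorem1p5:
  assumes star: "\<forall>n::int. n > 0 \<and> odd n \<and> squarefree n \<and> 3 dvd n \<and>
      (\<exists>p\<in>{5, 7, 13}. p dvd n \<and> (\<forall>r\<in>{5, 7, 13} - {p}. \<not> r dvd n) \<and>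
         (\<exists>q\<in>toda_primes (3 * p) - {5, 7, 13}. \<not> q dvd n))
      \<longrightarrow> toda_count n \<ge> 4"
  shows "\<forall>n::int. n > 0 \<longrightarrow>
      toda_count n \<ge> 1 \<and> (\<not> 5 dvd n \<longrightarrow> toda_count n \<ge> 2) \<and> (3 dvd n \<longrightarrow> toda_count n \<ge> 3)"
proof (intro allI impI)
  fix n :: int assume "n > 0"
  have count: "toda_count n \<ge> card A" if "A \<subseteq> toda_primes n" for A
    unfolding toda_count_def using finite_toda_primes that by (rule card_mono)
  show "toda_count n \<ge> 1 \<and> (\<not> 5 dvd n \<longrightarrow> toda_count n \<ge> 2) \<and> (3 dvd n \<longrightarrow> toda_count n \<ge> 3)"
  proof (cases "3 dvd n")
    case False
    then have T3: "3 \<in> toda_primes n"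
      by (simp add: toda_primes_def toda_prime_iff)
    moreover have "5 \<in> toda_primes n" if "\<not> 5 dvd n"
      using that by (simp add: toda_primes_def toda_prime_iff)
    ultimately show ?thesis
      using count[of "{3}"] count[of "{3, 5}"] False by auto
  next
    case True
    \<comment> \<open>Here 10 divides 60, 28 divides 84 and 52 divides 156, so 11, 29 and 53 are
      Toda primes of 15, 21 and 39.\<close>
    have primes: "prime (11 :: int)" "prime (29 :: int)" "prime (53 :: int)" by simp_all
    have ex: "\<exists>s. s \<in> toda_closure (insert q ({5, 7, 13} - {p})) \<and> s \<in> toda_primes n"
      if "p \<in> {5, 7, 13}" "q \<in> toda_primes (3 * p) - {5, 7, 13}" for p q
      using toda_closure_meets_toda_primes[OF star _ that, of n] \<open>n > 0\<close> by auto
    obtain a where a: "a \<in> toda_closure (insert 11 ({5, 7, 13} - {5}))" "a \<in> toda_primes n"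
      using ex[of 5 11] primes by (auto simp: toda_primes_def toda_prime_iff)
    obtain b where b: "b \<in> toda_closure (insert 29 ({5, 7, 13} - {7}))" "b \<in> toda_primes n"
      using ex[of 7 29] primes by (auto simp: toda_primes_def toda_prime_iff)
    obtain c where c: "c \<in> toda_closure (insert 53 ({5, 7, 13} - {13}))" "c \<in> toda_primes n"
      using ex[of 13 53] primes by (auto simp: toda_primes_def toda_prime_iff)
    have "3 \<notin> toda_primes n"
      using True by (simp add: toda_primes_def toda_prime_iff)
    \<comment> \<open>Each excluded set omits a different element of \<open>{5, 7, 13}\<close>, so
      any two of them cover all three.\<close>
    moreover have "a = b \<Longrightarrow> a = 3"
      using a(1) b(1) by (auto elim!: toda_closure_Int)
    moreover have "a = c \<Longrightarrow> a = 3"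
      using a(1) c(1) by (auto elim!: toda_closure_Int)
    moreover have "b = c \<Longrightarrow> b = 3"
      using b(1) c(1) by (auto elim!: toda_closure_Int)
    ultimately have "card {a, b, c} = 3"
      using a(2) by (metis b(2) c(2) card_3_iff)
    moreover have "toda_count n \<ge> card {a, b, c}"
      using a(2) b(2) c(2) by (intro count) auto
    ultimately show ?thesis by simp
  qed
qed

end
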